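(* Let $q\in\mathbb{N}$ and let $A$ be a finite set of positive integers all coprime to $q$. For each $1\le k\le q$ let $n_k$ be the number of elements of $A$ congruent to $k$ modulo $q$. If $|A|>72\sqrt{q}$ and $$\sum_{k=1}^{q}n_k^2<\frac{|A|^3}{7776q},$$ then $\Sigma^*(A)$ covers all residue classes modulo $q$.
   Context: $\Sigma^*(A)$ is the set of sums $\sum_{a\in A'}a$ over nonempty subsets $A'\subseteq A$. *)

theory Defs
  imports Complex_Main "HOL-Number_Theory.Cong"
begin

definition nonempty_subset_sums :: "nat set \<Rightarrow> nat set" where
  "nonempty_subset_sums A = {\<Sum>B |B. B \<subseteq> A \<and> B \<noteq> {}}"

end

theory Submission
  imports Defs "HOL-Analysis.Convex"
begin

text \<open>
  For a set \<open>B\<close> of residues let \<open>\<lambda>(x) = |(B + x) - B|\<close>, a subadditive function of \<open>x\<close>. If \<open>S\<close> is a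
  set of units modulo \<open>q\<close>, Chowla's theorem shows that the \<open>k\<close>-fold sumset of \<open>S \<union> {0}\<close> has at least
  \<open>min q (k |S| + 1)\<close> elements; once this exceeds \<open>2 |B|\<close>, some element \<open>x\<close> of it has
  \<open>\<lambda>(x) \<ge> |B| / 2\<close>, so some \<open>a \<in> S\<close> has \<open>\<lambda>(a) \<ge> |B| / (2 k)\<close>, which is of order \<open>|S|\<close>. By
  Cauchy--Schwarz, the bound on the sum of the \<open>n\<^sub>k\<^sup>2\<close> forces every subset of \<open>A\<close> of proportional size
  to occupy at least of order \<open>q / |A|\<close> residue classes. Adding elements of \<open>A\<close> greedily therefore
  enlarges the set of subset sums by that much at each step, until more than half of all residues
  are reached. Doing this in two disjoint parts of \<open>A\<close> and applying the pigeonhole principle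
  yields all residues.
\<close>

context
  fixes q :: int
  assumes q_pos: "q > 0"
begin

section \<open>Translates, boundaries and sumsets of residues modulo \<open>q\<close>\<close>

definition translate :: "int \<Rightarrow> int set \<Rightarrow> int set" where
  "translate x B = (\<lambda>b. (b + x) mod q) ` B"

text \<open>This is the number of elements that \<open>B\<close> gains when its translate by
  \<open>x\<close> is joined to it.\<close>

definition boundary :: "int set \<Rightarrow> int \<Rightarrow> nat" where
  "boundary B x = card (translate x B - B)"

definition sumset :: "int set \<Rightarrow> int set \<Rightarrow> int set" where
  "sumset A B = {(a + b) mod q | a b. a \<in> A \<and> b \<in> B}"

fun iterated_sumset :: "nat \<Rightarrow> int set \<Rightarrow> int set" where
  "iterated_sumset 0 S = {0}"
| "iterated_sumset (Suc k) S = sumset (iterated_sumset k S) (insert 0 S)"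

text \<open>The base point \<open>b\<close> stands for elements already committed. With
  \<open>b\<close> an element of the ground set, the empty \<open>D\<close> is harmless and the sum
  is over a nonempty set.\<close>

definition shifted_sums :: "int \<Rightarrow> nat set \<Rightarrow> int set" where
  "shifted_sums b C = (\<lambda>D. (b + int (\<Sum>D)) mod q) ` Pow C"

lemma translate_subset: "translate x B \<subseteq> {0..<q}"
  using q_pos by (auto simp: translate_def)

lemma sumset_subset: "sumset A B \<subseteq> {0..<q}"
  using q_pos by (auto simp: sumset_def)

lemma translate_mod: "translate (x mod q) B = translate x B"
  by (simp add: translate_def mod_simps)

lemma translate_translate: "translate y (translate x B) = translate (x + y) B"
  by (simp add: translate_def image_image mod_simps add.assoc)

lemma inj_on_translate:
  assumes "B \<subseteq> {0..<q}"
  shows "inj_on (\<lambda>b. (b + x) mod q) B"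
proof (rule inj_onI)
  fix b c assume bc: "b \<in> B" "c \<in> B" "(b + x) mod q = (c + x) mod q"
  then have "(b + x - x) mod q = (c + x - x) mod q"
    by (metis mod_diff_left_eq)
  then have "b mod q = c mod q"
    by simp
  moreover have "b mod q = b" "c mod q = c"
    using bc assms by auto
  ultimately show "b = c"
    by simp
qed

lemma card_translate:
  assumes "B \<subseteq> {0..<q}"
  shows "card (translate x B) = card B"
  unfolding translate_def by (intro card_image inj_on_translate assms)

text \<open>A unit generates the additive group modulo \<open>q\<close>, so the orbit of any point
  of \<open>B\<close> under adding \<open>x\<close> is everything.\<close>

lemma translate_subset_self_imp_all:
  assumes "B \<subseteq> {0..<q}" "B \<noteq> {}" "coprime x q" "translate x B \<subseteq> B"
  shows "B = {0..<q}"
proof -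
  obtain b where b: "b \<in> B"
    using assms by blast
  have orbit: "(b + int k * x) mod q \<in> B" for k
  proof (induction k)
    case 0
    then show ?case using b assms(1) by (auto simp: subset_iff)
  next
    case (Suc k)
    then have "((b + int k * x) mod q + x) mod q \<in> B"
      using assms(4) by (auto simp: translate_def)
    then show ?case by (simp add: mod_simps algebra_simps)
  qed
  have "r \<in> B" if r: "r \<in> {0..<q}" for r
  proof -
    obtain y where y: "[x * y = 1] (mod q)"
      using assms(3) cong_solve_coprime_int by blast
    \<comment> \<open>With \<open>y\<close> inverse to \<open>x\<close>, this \<open>k\<close>
      solves \<open>b + k * x = r\<close> modulo \<open>q\<close>; reducing modulo \<open>q\<close>
      makes it a natural number, as \<open>orbit\<close> requires.\<close>
    define k where "k = nat (((r - b) * y) mod q)"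
    have k: "int k = ((r - b) * y) mod q"
      using q_pos by (simp add: k_def)
    have "[b + int k * x = b + (r - b) * y * x] (mod q)"
      unfolding k by (intro cong_add cong_mult) auto
    also have "[b + (r - b) * y * x = b + (r - b) * (x * y)] (mod q)"
      by (simp add: ac_simps)
    also have "[b + (r - b) * (x * y) = b + (r - b) * 1] (mod q)"
      by (intro cong_add cong_mult y) auto
    finally have "(b + int k * x) mod q = r"
      using r by (simp add: cong_def)
    then show ?thesis using orbit[of k] by simp
  qed
  then show ?thesis using assms(1) by blast
qed

text \<open>Chowla's theorem, by Davenport's transform.\<close>

lemma card_sumset_ge:
  assumes "A \<subseteq> {0..<q}" "B \<subseteq> {0..<q}" "A \<noteq> {}" "0 \<in> B"
    and "\<And>b. b \<in> B \<Longrightarrow> b \<noteq> 0 \<Longrightarrow> coprime b q"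
  shows "card (sumset A B) \<ge> min (nat q) (card A + card B - 1)"
  using assms
proof (induction "card B" arbitrary: A B rule: less_induct)
  case less
  have finA: "finite A" and finB: "finite B"
    using less.prems finite_subset by blast+
  have AB: "A \<subseteq> sumset A B"
  proof
    fix a assume "a \<in> A"
    then have "a = (a + 0) mod q"
      using less.prems(1) by auto
    then show "a \<in> sumset A B"
      using \<open>a \<in> A\<close> less.prems(4) unfolding sumset_def by blast
  qed
  have fin_sum: "finite (sumset A B)" for A B
    by (rule finite_subset[OF sumset_subset]) simp
  consider "B = {0}" | "A = {0..<q}" | b where "b \<in> B" "b \<noteq> 0" "A \<noteq> {0..<q}"
    using less.prems by blast
  then show ?case
  proof cases
    case 1
    then show ?thesis using card_mono[OF fin_sum AB] by simp
  next
    case 2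
    then show ?thesis using card_mono[OF fin_sum AB] by simp
  next
    case 3
    then have "\<not> translate b A \<subseteq> A"
      using translate_subset_self_imp_all[of A b] less.prems by blast
    then obtain a where a: "a \<in> A" "(a + b) mod q \<notin> A"
      by (auto simp: translate_def)
    \<comment> \<open>Davenport's transform moves material from \<open>B\<close> into
      \<open>A\<close>. Here \<open>0\<close> survives in \<open>B'\<close> because \<open>a\<close>
      lies in \<open>A\<close>, while \<open>b\<close> is dropped, so the induction on
      \<open>card B\<close> applies.\<close>
    define A' where "A' = A \<union> translate a B"
    define B' where "B' = {b \<in> B. (b + a) mod q \<in> A}"
    have "B' \<subset> B"
      using 3 a by (auto simp: B'_def add.commute)
    then have lt: "card B' < card B"
      using finB psubset_card_mono by blast
    have a0: "a mod q = a"
      using a less.prems by auto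
    have "card (sumset A' B') \<ge> min (nat q) (card A' + card B' - 1)"
    proof (rule less.hyps[OF lt])
      show "A' \<subseteq> {0..<q}"
        using less.prems translate_subset by (auto simp: A'_def)
    qed (use less.prems a a0 in \<open>auto simp: A'_def B'_def\<close>)
    \<comment> \<open>Inclusion-exclusion: the overlap of \<open>A\<close> with the translate of
      \<open>B\<close> by \<open>a\<close> is a copy of \<open>B'\<close>.\<close>
    moreover have "card A' + card B' = card A + card B"
    proof -
      have "translate a B \<inter> A = translate a B'"
        by (auto simp: translate_def B'_def)
      moreover have "card (translate a B') = card B'"
        using less.prems by (intro card_translate) (auto simp: B'_def)
      moreover have "card (translate a B) = card B"
        using less.prems by (intro card_translate)
      moreover have "finite (translate a B)"
        using finB by (simp add: translate_def)
      ultimately show ?thesis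
        using card_Un_Int[OF finA, of "translate a B"] by (simp add: A'_def Int_commute)
    qed
    moreover have "sumset A' B' \<subseteq> sumset A B"
    proof
      fix z assume "z \<in> sumset A' B'"
      then obtain u v where uv: "u \<in> A'" "v \<in> B" "(v + a) mod q \<in> A" "z = (u + v) mod q"
        by (auto simp: sumset_def B'_def)
      show "z \<in> sumset A B"
      proof (cases "u \<in> A")
        case True
        then show ?thesis using uv by (auto simp: sumset_def)
      next
        case False
        then obtain c where "c \<in> B" "u = (c + a) mod q"
          using uv by (auto simp: A'_def translate_def)
        \<comment> \<open>The shift \<open>a\<close> is handed from the first summand to the second:
          \<open>v + a\<close> lies in \<open>A\<close> by the choice of \<open>B'\<close>, and
          \<open>c\<close> lies in \<open>B\<close>.\<close>
        moreover from this have "z = ((v + a) mod q + c) mod q"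
          using uv by (simp add: mod_simps ac_simps)
        ultimately show ?thesis using uv by (auto simp: sumset_def)
      qed
    qed
    then have "card (sumset A' B') \<le> card (sumset A B)"
      by (intro card_mono fin_sum)
    ultimately show ?thesis by simp
  qed
qed

section \<open>Growth of iterated sumsets of units\<close>

lemma iterated_sumset_subset: "iterated_sumset k S \<subseteq> {0..<q}"
  using q_pos sumset_subset by (cases k) auto

lemma iterated_sumset_nonempty: "iterated_sumset k S \<noteq> {}"
  by (induction k) (auto simp: sumset_def)

text \<open>Since \<open>0\<close> is not in \<open>S\<close>, \<open>insert 0 S\<close> has one
  more element than \<open>S\<close>, which cancels the \<open>- 1\<close> in
  \<open>card_sumset_ge\<close>; each step gains \<open>card S\<close> until \<open>q\<close> is
  reached.\<close>

lemma card_iterated_sumset_ge: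
  assumes "S \<subseteq> {0<..<q}" "\<And>s. s \<in> S \<Longrightarrow> coprime s q"
  shows "card (iterated_sumset k S) \<ge> min (nat q) (k * card S + 1)"
proof (induction k)
  case 0
  then show ?case by simp
next
  case (Suc k)
  have "finite S" "0 \<notin> S"
    using assms(1) finite_subset by auto
  then have "card (insert 0 S) = card S + 1"
    by simp
  moreover have "card (iterated_sumset (Suc k) S)
      \<ge> min (nat q) (card (iterated_sumset k S) + card (insert 0 S) - 1)"
    unfolding iterated_sumset.simps
    by (rule card_sumset_ge)
      (use assms q_pos iterated_sumset_subset iterated_sumset_nonempty in auto)
  ultimately show ?case using Suc.IH by simp
qed

section \<open>Subadditivity of the boundary and translates with large boundary\<close>

lemma boundary_mod: "boundary B (x mod q) = boundary B x"
  by (simp add: boundary_def translate_mod)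

lemma boundary_0:
  assumes "B \<subseteq> {0..<q}"
  shows "boundary B 0 = 0"
proof -
  have "translate 0 B \<subseteq> B"
    using assms by (auto simp: translate_def subset_iff)
  then show ?thesis
    by (metis Diff_eq_empty_iff boundary_def card.empty)
qed

text \<open>A point translated by \<open>x\<close> and then by \<open>y\<close> ends outside
  \<open>B\<close> only if it had already left \<open>B\<close> after \<open>x\<close>, or if it
  leaves \<open>B\<close> under \<open>y\<close>.\<close>

lemma boundary_add_le:
  assumes "B \<subseteq> {0..<q}"
  shows "boundary B (x + y) \<le> boundary B x + boundary B y"
proof -
  have fin: "finite (translate z C)" for z C
    by (rule finite_subset[OF translate_subset]) simp
  have "translate (x + y) B - B \<subseteq> translate y (translate x B - B) \<union> (translate y B - B)"
    unfolding translate_translate[symmetric] by (auto simp: translate_def)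
  then have "boundary B (x + y) \<le> card (translate y (translate x B - B) \<union> (translate y B - B))"
    unfolding boundary_def by (intro card_mono) (auto simp: fin)
  also have "\<dots> \<le> card (translate y (translate x B - B)) + boundary B y"
    unfolding boundary_def by (rule card_Un_le)
  also have "card (translate y (translate x B - B)) = boundary B x"
    unfolding boundary_def using translate_subset by (intro card_translate) blast
  finally show ?thesis .
qed

lemma boundary_iterated_sumset_le:
  assumes "B \<subseteq> {0..<q}" "\<And>s. s \<in> S \<Longrightarrow> real (boundary B s) \<le> t" "t \<ge> 0"
    and "x \<in> iterated_sumset k S"
  shows "real (boundary B x) \<le> real k * t"
  using assms(4)
proof (induction k arbitrary: x)
  case 0
  then show ?case using boundary_0[OF assms(1)] by simp
next
  case (Suc k)
  then obtain y s where ys: "y \<in> iterated_sumset k S" "s \<in> insert 0 S" "x = (y + s) mod q"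
    by (auto simp: sumset_def)
  have "boundary B x \<le> boundary B y + boundary B s"
    using boundary_add_le[OF assms(1)] by (simp add: ys boundary_mod)
  moreover have "real (boundary B s) \<le> t"
    using ys assms(2,3) boundary_0[OF assms(1)] by auto
  moreover have "real (boundary B y) \<le> real k * t"
    using Suc.IH ys by blast
  ultimately show ?case by (simp add: algebra_simps)
qed

text \<open>Double counting: a pair of \<open>x\<close> and \<open>c\<close> with both
  \<open>c\<close> and \<open>c - x\<close> in \<open>B\<close> modulo \<open>q\<close> is
  determined by these two elements of \<open>B\<close>.\<close>

lemma sum_card_translate_Int_le:
  assumes "B \<subseteq> {0..<q}" "T \<subseteq> {0..<q}"
  shows "(\<Sum>x\<in>T. card (translate x B \<inter> B)) \<le> card B ^ 2"
proof -
  have fin: "finite T" "finite B"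
    using assms finite_subset by blast+
  define P where "P = (SIGMA x:T. translate x B \<inter> B)"
  have "inj_on (\<lambda>(x, c). (c, (c - x) mod q)) P"
  proof (rule inj_onI)
    fix u v assume uv: "u \<in> P" "v \<in> P"
      "(case u of (x, c) \<Rightarrow> (c, (c - x) mod q)) = (case v of (x, c) \<Rightarrow> (c, (c - x) mod q))"
    obtain x c y d where xc: "u = (x, c)" "v = (y, d)"
      by fastforce
    have "c = d" and eq: "(c - x) mod q = (c - y) mod q"
      using uv xc by auto
    have "(c - (c - x)) mod q = (c - (c - y)) mod q"
      using eq by (metis mod_diff_right_eq)
    moreover have "x mod q = x" "y mod q = y"
      using uv xc assms by (auto simp: P_def)
    ultimately show "u = v"
      using xc \<open>c = d\<close> by simp
  qed
  moreover have "(\<lambda>(x, c). (c, (c - x) mod q)) ` P \<subseteq> B \<times> B"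
    using assms by (auto simp: P_def translate_def mod_simps subset_iff)
  ultimately have "card P \<le> card (B \<times> B)"
    using fin by (intro card_inj_on_le) auto
  moreover have "card P = (\<Sum>x\<in>T. card (translate x B \<inter> B))"
    unfolding P_def using fin by (intro card_SigmaI) auto
  ultimately show ?thesis
    by (simp add: card_cartesian_product power2_eq_square)
qed

text \<open>If all of \<open>S\<close> had small boundary, so would at least
  \<open>2 * card B\<close> elements of an iterated sumset. Their translates would overlap
  \<open>B\<close> more than double counting allows.\<close>

lemma exists_large_boundary:
  assumes B: "B \<subseteq> {0..<q}" "B \<noteq> {}" "2 * int (card B) \<le> q"
    and S: "S \<subseteq> {0<..<q}" "\<And>s. s \<in> S \<Longrightarrow> coprime s q"
    and sigma: "\<sigma> > 0" "\<sigma> \<le> real (card S)" "\<sigma> \<le> real (card B)"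
  shows "\<exists>a\<in>S. real (boundary B a) \<ge> \<sigma> / 7"
proof (rule ccontr)
  assume "\<not> ?thesis"
  then have small: "\<And>s. s \<in> S \<Longrightarrow> real (boundary B s) \<le> \<sigma> / 7"
    by force
  have finB: "finite B"
    using B finite_subset by blast
  \<comment> \<open>The least \<open>k\<close> with \<open>k * \<sigma>\<close> at least
    \<open>2 * card B\<close>. Rounding up costs at most \<sigma>, hence at most
    \<open>card B\<close>, which gives the upper bound \<open>3 * card B\<close>.\<close>
  define k where "k = nat \<lceil>2 * real (card B) / \<sigma>\<rceil>"
  define T where "T = iterated_sumset k S"
  have kge: "real k \<ge> 2 * real (card B) / \<sigma>" and kle: "real k \<le> 2 * real (card B) / \<sigma> + 1"
  proof -
    have "2 * real (card B) / \<sigma> \<ge> 0"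
      using sigma by simp
    then show "real k \<ge> 2 * real (card B) / \<sigma>" "real k \<le> 2 * real (card B) / \<sigma> + 1"
      unfolding k_def by linarith+
  qed
  have k_sigma: "2 * real (card B) \<le> real k * \<sigma>" "real k * \<sigma> \<le> 3 * real (card B)"
    using kge kle sigma by (auto simp: field_simps)
  have "real k * \<sigma> \<le> real k * real (card S)"
    using sigma by (intro mult_left_mono) auto
  then have "2 * card B \<le> k * card S"
    using k_sigma by (metis (mono_tags, lifting) of_nat_le_iff of_nat_mult of_nat_numeral order_trans)
  then have card_T: "2 * card B \<le> card T"
    using card_iterated_sumset_ge[OF S, of k] B(3) unfolding T_def by linarith
  have T: "T \<subseteq> {0..<q}"
    unfolding T_def by (rule iterated_sumset_subset)
  \<comment> \<open>The boundary is at most \<open>k * \<sigma> / 7\<close>, so at most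
    \<open>3 / 7\<close> of \<open>B\<close> is lost. The constant 7 leaves \<open>4 / 7\<close>,
    more than the half needed for a contradiction with \<open>2 * card B\<close> translates.\<close>
  have overlap: "real (card (translate x B \<inter> B)) \<ge> 4 / 7 * real (card B)" if x: "x \<in> T" for x
  proof -
    have "card (translate x B \<inter> B) + boundary B x = card (translate x B)"
      unfolding boundary_def using finB
      by (subst card_Int_Diff[symmetric]) (auto simp: translate_def)
    then have "real (card (translate x B \<inter> B)) + real (boundary B x) = real (card B)"
      using card_translate[OF B(1), of x] by linarith
    moreover have "real (boundary B x) \<le> real k * (\<sigma> / 7)"
      using boundary_iterated_sumset_le[OF B(1) small, where x = x and k = k] x sigma
      by (simp add: T_def)
    ultimately show ?thesis using k_sigma(2) by simp
  qed
  have pos: "real (card B) > 0"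
    using B finB by (simp add: card_gt_0_iff)
  have "2 * real (card B) * (4 / 7 * real (card B)) \<le> real (card T) * (4 / 7 * real (card B))"
    using card_T by (intro mult_right_mono) linarith+
  also have "\<dots> = (\<Sum>x\<in>T. 4 / 7 * real (card B))"
    by simp
  also have "\<dots> \<le> (\<Sum>x\<in>T. real (card (translate x B \<inter> B)))"
    by (intro sum_mono overlap)
  also have "\<dots> = real (\<Sum>x\<in>T. card (translate x B \<inter> B))"
    by simp
  also have "\<dots> \<le> real (card B ^ 2)"
    using sum_card_translate_Int_le[OF B(1) T] by (rule of_nat_mono)
  finally have "8 / 7 * real (card B) ^ 2 \<le> real (card B) ^ 2"
    by (simp add: power2_eq_square)
  moreover have "real (card B) ^ 2 > 0"
    using pos by simp
  ultimately show False
    by linarith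
qed

section \<open>Greedy growth of sets of subset sums\<close>

lemma shifted_sums_subset: "shifted_sums b C \<subseteq> {0..<q}"
  using q_pos by (auto simp: shifted_sums_def)

lemma shifted_sums_nonempty: "shifted_sums b C \<noteq> {}"
  by (auto simp: shifted_sums_def)

lemma card_shifted_sums_pos: "card (shifted_sums b C) > 0"
  using shifted_sums_nonempty finite_subset[OF shifted_sums_subset]
  by (simp add: card_gt_0_iff)

lemma card_shifted_sums_insert:
  assumes "finite C" "a \<notin> C"
  shows "card (shifted_sums b (insert a C))
    = card (shifted_sums b C) + boundary (shifted_sums b C) (int a)"
proof -
  have "shifted_sums b (insert a C) = shifted_sums b C \<union> translate (int a) (shifted_sums b C)"
  proof -
    have "(b + int (\<Sum>(insert a D))) mod q = ((b + int (\<Sum>D)) mod q + int a) mod q"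
      if "D \<in> Pow C" for D
    proof -
      have "finite D" "a \<notin> D"
        using that assms finite_subset by auto
      then have "\<Sum>(insert a D) = a + \<Sum>D"
        by simp
      then show ?thesis
        by (simp add: mod_simps ac_simps)
    qed
    then have "(\<lambda>D. (b + int (\<Sum>D)) mod q) ` insert a ` Pow C
        = translate (int a) (shifted_sums b C)"
      unfolding translate_def shifted_sums_def image_image by (intro image_cong) auto
    then show ?thesis
      by (simp add: shifted_sums_def Pow_insert image_Un)
  qed
  then have "card (shifted_sums b (insert a C))
      = card (shifted_sums b C \<union> (translate (int a) (shifted_sums b C) - shifted_sums b C))"
    by simp
  also have "\<dots> = card (shifted_sums b C) + boundary (shifted_sums b C) (int a)"
    unfolding boundary_def
    by (intro card_Un_disjoint)
      (auto intro: finite_subset[OF shifted_sums_subset] finite_subset[OF translate_subset])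
  finally show ?thesis .
qed

text \<open>A set of at most half the residues is not closed under adding a unit, so every new
  element gains at least one sum. This slow phase only secures a starting size.\<close>

lemma exists_many_shifted_sums_linear:
  assumes "finite C" "\<And>a. a \<in> C \<Longrightarrow> coprime (int a) q" "j \<le> card C"
  shows "\<exists>D\<subseteq>C. card D = j \<and> (2 * int (card (shifted_sums b D)) > q
    \<or> card (shifted_sums b D) \<ge> j + 1)"
  using assms(3)
proof (induction j)
  case 0
  show ?case
    using card_shifted_sums_pos[of b "{}"] by (intro exI[of _ "{}"]) simp
next
  case (Suc j)
  then obtain D where D: "D \<subseteq> C" "card D = j"
    "2 * int (card (shifted_sums b D)) > q \<or> card (shifted_sums b D) \<ge> j + 1"
    by auto
  have finD: "finite D"
    using D assms finite_subset by blast
  have "D \<noteq> C"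
    using D Suc.prems by auto
  then obtain a where a: "a \<in> C" "a \<notin> D"
    using D by blast
  have card_eq: "card (shifted_sums b (insert a D))
      = card (shifted_sums b D) + boundary (shifted_sums b D) (int a)"
    by (rule card_shifted_sums_insert[OF finD a(2)])
  have "boundary (shifted_sums b D) (int a) \<ge> 1" if le: "2 * int (card (shifted_sums b D)) \<le> q"
  proof (rule ccontr)
    assume "\<not> ?thesis"
    then have "translate (int a) (shifted_sums b D) - shifted_sums b D = {}"
      using finite_subset[OF translate_subset, of "int a" "shifted_sums b D"]
      by (simp add: boundary_def not_le)
    then have "shifted_sums b D = {0..<q}"
      using translate_subset_self_imp_all[OF shifted_sums_subset shifted_sums_nonempty] assms(2) a
      by blast
    then show False
      using le q_pos by simp
  qed
  then show ?case
    using D a finD card_eq by (intro exI[of _ "insert a D"]) force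
qed

lemma exists_many_shifted_sums:
  assumes "finite C" "\<And>a. a \<in> C \<Longrightarrow> coprime (int a) q" "q > 1"
    and "h + i \<le> card C" "\<sigma> > 0" "\<sigma> \<le> real h + 1"
    and res: "\<And>D. D \<subseteq> C \<Longrightarrow> card D \<ge> card C - (h + i) \<Longrightarrow>
      real (card ((\<lambda>a. int a mod q) ` D)) \<ge> \<sigma>"
  shows "\<exists>D\<subseteq>C. card D = h + i \<and> (2 * int (card (shifted_sums b D)) > q
    \<or> real (card (shifted_sums b D)) \<ge> real h + 1 + real i * (\<sigma> / 7))"
proof -
  have "\<exists>D\<subseteq>C. card D = h + l \<and> (2 * int (card (shifted_sums b D)) > q
    \<or> real (card (shifted_sums b D)) \<ge> real h + 1 + real l * (\<sigma> / 7))" if "l \<le> i" for l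
    using that
  proof (induction l)
    case 0
    have "h \<le> card C"
      using assms(4) by simp
    from exists_many_shifted_sums_linear[OF assms(1,2) this, of b]
    obtain D where "D \<subseteq> C" "card D = h"
      "2 * int (card (shifted_sums b D)) > q \<or> card (shifted_sums b D) \<ge> h + 1"
      by blast
    then show ?case
      by (intro exI[of _ D]) auto
  next
    case (Suc l)
    then obtain D where D: "D \<subseteq> C" "card D = h + l"
      "2 * int (card (shifted_sums b D)) > q
        \<or> real (card (shifted_sums b D)) \<ge> real h + 1 + real l * (\<sigma> / 7)"
      by auto
    have finD: "finite D"
      using D assms finite_subset by blast
    define S where "S = (\<lambda>a. int a mod q) ` (C - D)"
    have card_CD: "card (C - D) = card C - (h + l)"
      using D finD by (simp add: card_Diff_subset)
    have card_S: "real (card S) \<ge> \<sigma>"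
      unfolding S_def using Suc.prems card_CD by (intro res) auto
    have unit_S: "coprime s q" if "s \<in> S" for s
      using that assms(2) q_pos by (auto simp: S_def)
    have "0 \<notin> S"
      using unit_S[of 0] assms(3) by (intro notI) simp
    moreover have "S \<subseteq> {0..<q}"
      using q_pos by (auto simp: S_def)
    ultimately have S: "S \<subseteq> {0<..<q}"
      by (force simp: less_le)
    obtain a where a: "a \<in> C - D"
      "2 * int (card (shifted_sums b D)) \<le> q \<Longrightarrow> real (boundary (shifted_sums b D) (int a)) \<ge> \<sigma> / 7"
    proof (cases "2 * int (card (shifted_sums b D)) \<le> q")
      case True
      then have "real (card (shifted_sums b D)) \<ge> real h + 1 + real l * (\<sigma> / 7)"
        using D by auto
      moreover have "real l * (\<sigma> / 7) \<ge> 0"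
        using assms by simp
      ultimately have "\<sigma> \<le> real (card (shifted_sums b D))"
        using assms(6) by linarith
      then have "\<exists>s\<in>S. real (boundary (shifted_sums b D) s) \<ge> \<sigma> / 7"
        using exists_large_boundary[OF shifted_sums_subset shifted_sums_nonempty True S unit_S]
          assms(5) card_S by blast
      then show ?thesis
        using that by (auto simp: S_def boundary_mod)
    next
      case False
      have "S \<noteq> {}"
        using card_S assms(5) by auto
      then show ?thesis
        using that False by (auto simp: S_def)
    qed
    have card_eq: "card (shifted_sums b (insert a D))
        = card (shifted_sums b D) + boundary (shifted_sums b D) (int a)"
      using a by (intro card_shifted_sums_insert[OF finD]) auto
    show ?case
    proof (intro exI conjI)
      show "insert a D \<subseteq> C"
        using D a by auto
      show "card (insert a D) = h + Suc l"
        using D a finD by simp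
      show "2 * int (card (shifted_sums b (insert a D))) > q
        \<or> real (card (shifted_sums b (insert a D))) \<ge> real h + 1 + real (Suc l) * (\<sigma> / 7)"
        using D(3) a(2) unfolding card_eq
        by (cases "2 * int (card (shifted_sums b D)) \<le> q") (auto simp: field_simps)
    qed
  qed
  then show ?thesis
    by blast
qed

lemma shifted_sums_mono:
  assumes "D \<subseteq> C"
  shows "shifted_sums b D \<subseteq> shifted_sums b C"
  using assms by (auto simp: shifted_sums_def)

text \<open>Pigeonhole: \<open>X\<close> and the reflection \<open>r - Y\<close> together have more
  than \<open>q\<close> elements, so they meet.\<close>

lemma exists_sum_mod_eq:
  assumes "X \<subseteq> {0..<q}" "Y \<subseteq> {0..<q}" "int (card X) + int (card Y) > q"
  shows "\<exists>x\<in>X. \<exists>y\<in>Y. [x + y = r] (mod q)"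
proof (rule ccontr)
  assume neg: "\<not> ?thesis"
  define Z where "Z = (\<lambda>y. (r - y) mod q) ` Y"
  have "inj_on (\<lambda>y. (r - y) mod q) Y"
  proof (rule inj_onI)
    fix y z assume yz: "y \<in> Y" "z \<in> Y" "(r - y) mod q = (r - z) mod q"
    then have "(r - (r - y)) mod q = (r - (r - z)) mod q"
      by (metis mod_diff_right_eq)
    moreover have "y mod q = y" "z mod q = z"
      using yz assms by auto
    ultimately show "y = z"
      by simp
  qed
  then have "card Z = card Y"
    unfolding Z_def by (rule card_image)
  moreover have "X \<inter> Z = {}"
  proof -
    have "[(r - y) mod q + y = r] (mod q)" for y
      by (simp add: cong_def mod_simps)
    then show ?thesis
      using neg by (auto simp: Z_def)
  qed
  moreover have XZ: "X \<subseteq> {0..<q}" "Z \<subseteq> {0..<q}"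
    using assms q_pos by (auto simp: Z_def)
  moreover have "finite X" "finite Z"
    using XZ finite_subset by blast+
  ultimately have "card X + card Y = card (X \<union> Z)"
    by (simp add: card_Un_disjoint)
  also have "\<dots> \<le> card {0..<q}"
    using XZ by (intro card_mono) auto
  finally show False
    using assms(3) q_pos by simp
qed

end

text \<open>Cauchy-Schwarz for the fibre sizes of \<open>f\<close>: an upper bound on the sum of
  their squares forces many distinct values.\<close>

lemma card_squared_le_card_image_mult:
  fixes D :: "'a set" and f :: "'a \<Rightarrow> 'b"
  assumes "finite D"
  shows "real (card D) ^ 2 \<le> real (card (f ` D)) * (\<Sum>k\<in>f ` D. real (card {a \<in> D. f a = k}) ^ 2)"
proof -
  have "card D = (\<Sum>k\<in>f ` D. card {a \<in> D. f a = k})"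
    using sum.image_gen[OF assms, of "\<lambda>_. 1::nat" f] by simp
  then have "real (card D) = (\<Sum>k\<in>f ` D. real (card {a \<in> D. f a = k}))"
    by simp
  then show ?thesis
    using sum_squared_le_sum_of_squares[of "\<lambda>k. real (card {a \<in> D. f a = k})" "f ` D"]
    by (simp add: mult.commute)
qed

section \<open>Choice of constants and combination of two disjoint halves\<close>

theorem theorem5p5:
  fixes q :: nat and A :: "nat set" and n :: "nat \<Rightarrow> nat"
  assumes "q \<ge> 1"
    and "finite A"
    and "\<And>a. a \<in> A \<Longrightarrow> a > 0"
    and "\<And>a. a \<in> A \<Longrightarrow> coprime a q"
    and "\<And>k. 1 \<le> k \<Longrightarrow> k \<le> q \<Longrightarrow> n k = card {a \<in> A. [a = k] (mod q)}"
    and "real (card A) > 72 * sqrt (real q)"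
    and "(\<Sum>k=1..q. (real (n k))\<^sup>2) < real (card A) ^ 3 / (7776 * real q)"
  shows "\<forall>r::nat. \<exists>s \<in> nonempty_subset_sums A. [s = r] (mod q)"
proof (cases "q = 1")
  case True
  have "A \<noteq> {}"
    using assms(6) by auto
  then show ?thesis
    using True by (auto simp: nonempty_subset_sums_def)
next
  case False
  then have q2: "q > 1"
    using assms(1) by simp
  define m where "m = card A"
  \<comment> \<open>Two disjoint sets of size \<open>4 * h\<close> and one further element must fit
    into \<open>A\<close>, while \<open>h\<close> stays at least \<open>m / 12\<close>; both hold as
    \<open>m\<close> is at least 73.\<close>
  define h where "h = m div 10"
  \<comment> \<open>Cauchy-Schwarz yields this number of classes for a subset of size
    \<open>m / 6\<close>: \<open>(m / 6)^2\<close> divided by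
    \<open>m^3 / (7776 * q)\<close>.\<close>
  define \<sigma> where "\<sigma> = 216 * real q / real m"
  have m72: "real m > 72 * sqrt (real q)"
    using assms(6) by (simp add: m_def)
  have "sqrt (real q) \<ge> 1"
    using assms(1) by simp
  then have "real m > 72"
    using m72 by linarith
  then have m: "m \<ge> 73"
    by linarith
  have "(72 * sqrt (real q))\<^sup>2 < (real m)\<^sup>2"
    using m72 by (intro power_strict_mono) auto
  then have msq: "5184 * real q < (real m)\<^sup>2"
    by (simp add: power_mult_distrib)
  have h: "real h \<ge> real m / 12"
  proof -
    have "12 * h \<ge> m"
      using m unfolding h_def by presburger
    then show ?thesis by linarith
  qed
  have sigma_pos: "\<sigma> > 0"
    using q2 m by (simp add: \<sigma>_def)
  have sigma_h: "\<sigma> \<le> real h + 1"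
  proof -
    have "\<sigma> \<le> real m / 12"
      using msq m by (simp add: \<sigma>_def field_simps power2_eq_square)
    then show ?thesis
      using h by linarith
  qed
  have residues: "real (card ((\<lambda>a. int a mod int q) ` D)) \<ge> \<sigma>"
    if D: "D \<subseteq> A" "card D \<ge> 2 * h" for D
  proof -
    have finD: "finite D"
      using D assms(2) finite_subset by blast
    define R where "R = (\<lambda>a. a mod q) ` D"
    define N where "N = (\<Sum>k=1..q. (real (n k))\<^sup>2)"
    \<comment> \<open>Remainders start at 0 while \<open>n\<close> is indexed from 1 to
      \<open>q\<close>; coprimality with \<open>q > 1\<close> excludes the remainder 0.\<close>
    have R: "R \<subseteq> {1..q}"
    proof
      fix k assume "k \<in> R"
      then obtain a where a: "a \<in> D" "k = a mod q"
        by (auto simp: R_def)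
      have "coprime k q"
        using a D assms(4) q2 by auto
      then have "k \<noteq> 0"
        using q2 by (intro notI) simp
      moreover have "k < q"
        using a q2 by simp
      ultimately show "k \<in> {1..q}"
        by simp
    qed
    have "(\<Sum>k\<in>R. real (card {a \<in> D. a mod q = k}) ^ 2) \<le> (\<Sum>k\<in>R. (real (n k))\<^sup>2)"
    proof (intro sum_mono power_mono of_nat_mono)
      fix k assume k: "k \<in> R"
      then have "k mod q = k"
        by (auto simp: R_def)
      then have "{a \<in> D. a mod q = k} \<subseteq> {a \<in> A. [a = k] (mod q)}"
        using D by (auto simp: cong_def)
      moreover have "n k = card {a \<in> A. [a = k] (mod q)}"
        using k R by (intro assms(5)) auto
      ultimately show "card {a \<in> D. a mod q = k} \<le> n k"
        using assms(2) by (simp add: card_mono)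
    qed auto
    also have "\<dots> \<le> N"
      unfolding N_def using R by (intro sum_mono2) auto
    finally have N: "(\<Sum>k\<in>R. real (card {a \<in> D. a mod q = k}) ^ 2) \<le> N" .
    have "(real m / 6)\<^sup>2 \<le> (real (card D))\<^sup>2"
      using D h by (intro power_mono) linarith+
    also have "\<dots> \<le> real (card R) * (\<Sum>k\<in>R. real (card {a \<in> D. a mod q = k}) ^ 2)"
      unfolding R_def by (rule card_squared_le_card_image_mult[OF finD])
    also have "\<dots> \<le> real (card R) * (real m ^ 3 / (7776 * real q))"
      using N assms(7) by (intro mult_left_mono) (auto simp: N_def m_def)
    finally have "(real m)\<^sup>2 * (216 * real q) \<le> (real m)\<^sup>2 * (real (card R) * real m)"
      using q2 by (simp add: field_simps power2_eq_square power3_eq_cube)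
    then have "\<sigma> \<le> real (card R)"
      using m by (simp add: \<sigma>_def field_simps)
    moreover have "(\<lambda>a. int a mod int q) ` D = int ` R"
      by (simp add: R_def image_image zmod_int)
    ultimately show ?thesis
      by (simp add: card_image)
  qed
  \<comment> \<open>Of the \<open>4 * h\<close> elements, \<open>h\<close> serve the slow phase and
    \<open>h\<close> the fast one; the \<open>2 * h\<close> left over keep \<open>residues\<close>
    applicable throughout.\<close>
  have half: "2 * int (card (shifted_sums (int q) b C)) > int q"
    if C: "C \<subseteq> A" "card C = 4 * h" for b C
  proof -
    have finC: "finite C"
      using C assms(2) finite_subset by blast
    have "\<exists>D\<subseteq>C. card D = h + h \<and> (2 * int (card (shifted_sums (int q) b D)) > int q
      \<or> real (card (shifted_sums (int q) b D)) \<ge> real h + 1 + real h * (\<sigma> / 7))"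
    proof (rule exists_many_shifted_sums)
      show "coprime (int a) (int q)" if "a \<in> C" for a
        using that C assms(4) by auto
      show "real (card ((\<lambda>a. int a mod int q) ` D)) \<ge> \<sigma>"
        if "D \<subseteq> C" "card D \<ge> card C - (h + h)" for D
        using that C by (intro residues) auto
    qed (use finC C q2 sigma_pos sigma_h in auto)
    then obtain D where D: "D \<subseteq> C" "2 * int (card (shifted_sums (int q) b D)) > int q
      \<or> real (card (shifted_sums (int q) b D)) \<ge> real h + 1 + real h * (\<sigma> / 7)"
      by blast
    have "real m / 12 * (\<sigma> / 7) \<le> real h * (\<sigma> / 7)"
      using h sigma_pos by (intro mult_right_mono) auto
    \<comment> \<open>The fast phase alone would gain \<open>216 / 84 = 18 / 7\<close> times
      \<open>q\<close>, so either alternative for \<open>D\<close> gives more than half of the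
      residues.\<close>
    moreover have "real m / 12 * (\<sigma> / 7) = 18 / 7 * real q"
      using m by (simp add: \<sigma>_def)
    ultimately have "2 * int (card (shifted_sums (int q) b D)) > int q"
      using D(2) by linarith
    moreover have "card (shifted_sums (int q) b D) \<le> card (shifted_sums (int q) b C)"
      using q2 D(1)
      by (intro card_mono shifted_sums_mono) (auto intro: finite_subset[OF shifted_sums_subset])
    ultimately show ?thesis
      by linarith
  qed
  have "A \<noteq> {}"
    using m by (auto simp: m_def)
  \<comment> \<open>This element is set aside as the base point for \<open>C1\<close>, so that the
    final subset is nonempty even if \<open>D1\<close> and \<open>D2\<close> are empty.\<close>
  then obtain a0 where a0: "a0 \<in> A"
    by blast
  have "4 * h \<le> card (A - {a0})"
    using a0 m by (simp add: h_def m_def)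
  then obtain C1 where C1: "C1 \<subseteq> A - {a0}" "card C1 = 4 * h" "finite C1"
    using obtain_subset_with_card_n by metis
  have "4 * h \<le> card (A - {a0} - C1)"
    using a0 m C1 by (simp add: card_Diff_subset h_def m_def)
  then obtain C2 where C2: "C2 \<subseteq> A - {a0} - C1" "card C2 = 4 * h" "finite C2"
    using obtain_subset_with_card_n by metis
  show ?thesis
  proof
    fix r :: nat
    have "\<exists>x\<in>shifted_sums (int q) (int a0) C1. \<exists>y\<in>shifted_sums (int q) 0 C2.
        [x + y = int r] (mod int q)"
    proof (rule exists_sum_mod_eq)
      have "C1 \<subseteq> A" "C2 \<subseteq> A"
        using C1 C2 by auto
      then show "int (card (shifted_sums (int q) (int a0) C1))
          + int (card (shifted_sums (int q) 0 C2)) > int q"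
        using half[of C1 "int a0"] half[of C2 0] C1 C2 by linarith
    qed (use q2 shifted_sums_subset in auto)
    then obtain D1 D2 where D: "D1 \<subseteq> C1" "D2 \<subseteq> C2"
      "[(int a0 + int (\<Sum>D1)) mod int q + (0 + int (\<Sum>D2)) mod int q = int r] (mod int q)"
      using q2 by (auto simp: shifted_sums_def simp del: of_nat_sum)
    have fin: "finite D1" "finite D2"
      using D C1 C2 finite_subset by blast+
    have "[int (a0 + \<Sum>D1 + \<Sum>D2) = int r] (mod int q)"
      using D(3) by (simp add: cong_def mod_simps)
    then have cong: "[a0 + \<Sum>D1 + \<Sum>D2 = r] (mod q)"
      by (simp only: cong_int_iff)
    have "\<Sum>(insert a0 (D1 \<union> D2)) = a0 + \<Sum>(D1 \<union> D2)"
      using fin D C1 C2 by (intro sum.insert) auto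
    also have "\<Sum>(D1 \<union> D2) = \<Sum>D1 + \<Sum>D2"
      using fin D C2 by (intro sum.union_disjoint) auto
    finally have "[\<Sum>(insert a0 (D1 \<union> D2)) = r] (mod q)"
      using cong by (simp add: add.assoc)
    moreover have "insert a0 (D1 \<union> D2) \<subseteq> A"
      using D C1 C2 a0 by auto
    ultimately show "\<exists>s\<in>nonempty_subset_sums A. [s = r] (mod q)"
      unfolding nonempty_subset_sums_def by blast
  qed
qed

end
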